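(* Let $n,d\ge1$ be integers and let $k$ be an integer with $nd\ge k\ge d$. Let $\lambda$ be a partition of $nd-k$ with length at most $n-1$. (a) We have $$c^{n,d}_\lambda=\sum_{i_1,\ldots,i_{n-1}}\ \prod_{j=1}^{n-1}\binom{jd-i_1-\cdots-i_{j-1}}{i_j},$$ where the sum is over all sequences $i_1,\ldots,i_{n-1}$ of nonnegative integers whose nonzero terms are the parts of $\lambda$ (up to reordering). (b) We have $$c^{n,d}_\lambda=\frac{1}{(k-1)!}\,\frac{1}{\prod_i(\lambda_i!)}\sum_{i_1,\ldots,i_{n-1}}\ \prod_{j=1}^{n-1}(jd-i_1-\cdots-i_{j-1}),$$ where the sum is over all sequences $i_1,i_2,\ldots,i_{n-1}$ of nonnegative integers whose nonzero terms are the parts of $\lambda$ (up to reordering) and such that $i_1+i_2+\cdots+i_j\le jd$ for all $j$. (c) Let $\mathsf{M}(n)$ be the set of all lower triangular arrays $a=(a_{i,j})_{1\le j<i\le n}$ of nonnegative integers. To any such array associate the sequence $(r_2(a),r_3(a),\ldots,r_n(a))$ of its row sums, $r_i(a)=\sum_j a_{i,j}$, and the sequence $(c_1(a),c_2(a),\ldots,c_{n-1}(a))$ of its column sums, $c_j(a)=\sum_i a_{i,j}$. Then $$c^{n,d}_\lambda=\sum_a\frac{1}{\prod_{i,j}(a_{i,j}!)}\prod_{i=2}^n(d)_{r_i(a)},$$ where the sum is over all $a\in\mathsf{M}(n)$ whose nonzero column sums equal the parts of $\lambda$, up to reordering.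
   Context: $(q)_m=q(q-1)\cdots(q-m+1)$ denotes the falling factorial, with $(q)_0=1$. For a partition $\lambda=(\lambda_1\ge\cdots\ge\lambda_\ell>0)$, $|\lambda|$ is the sum of its parts, $\lambda\vdash m$ means $|\lambda|=m$, and the length $\ell(\lambda)=\ell$ is its number of parts; $y_\lambda=\prod_{i=1}^{\ell}y_{\lambda_i}$, with $y_\emptyset=1$. Let $R=\mathbb{Z}[y_i;\ i\geq 0]$ be the commutative polynomial ring, and let $R\langle t\rangle$ be the unital ring generated over $\mathbb{Z}$ by $t$ and the $y_i$, subject only to $y_iy_j=y_jy_i$ for all $i,j\ge0$ (so $t$ does not commute with the $y_i$). Let $\Delta$ be the derivation of $R\langle t\rangle$ (additive, satisfying the Leibniz rule) with $\Delta(y_i)=y_{i+1}$ for all $i\ge0$ and $\Delta(t)=0$, and let $\rho_t$ be right multiplication by $t$. For $d\ge1$ define $U_{0,d}=1$ and $U_{n+1,d}=y_0(\Delta+\rho_t)^dU_{n,d}$ for $n\ge0$. For $n,d\ge1$ the positive integers $c^{n,d}_\lambda$ (for partitions $\lambda$ with $0\le|\lambda|\le(n-1)d$ and $\ell(\lambda)\le n-1$) are the coefficients in $$U_{n,d}=\sum_{k=d}^{nd}\ \sum_{\substack{\lambda\vdash nd-k\\ \ell(\lambda)\le n-1}}c^{n,d}_\lambda\,y_0^{\,n-\ell(\lambda)}y_\lambda t^k.$$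
   Formalization: Part (b) as printed fails for d≥2 (n=1, d=k=3, λ empty: c=1 but the formula gives 1/2); it is proved with 1/(k-d)! in place of 1/(k-1)! and falling factorials (jd-i_1-...-i_{j-1})_d in place of the plain factors; for d=1 the two agree. *)

theory Defs
  imports Complex_Main "HOL-Library.Poly_Mapping" "HOL-Library.FuncSet" "HOL-Library.Multiset"
begin

text \<open>
  The ring \<open>R\<langle>t\<rangle>\<close>, presented by generators \<open>t, y\<^sub>0, y\<^sub>1, \<dots>\<close> and relations
  \<open>y\<^sub>i y\<^sub>j = y\<^sub>j y\<^sub>i\<close>, is the integral monoid ring of the monoid with the same presentation.
  That monoid is the quotient of the free monoid of lists of letters; it is written additively
  (\<open>+\<close> is concatenation and is not commutative), because the convolution product of
  \<open>'a \<Rightarrow>\<^sub>0 int\<close> is built from \<open>+\<close> on \<open>'a\<close>.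
\<close>

datatype letter = T | Y nat

inductive y_swap :: "letter list \<Rightarrow> letter list \<Rightarrow> bool" where
  "y_swap (u @ [Y i, Y j] @ v) (u @ [Y j, Y i] @ v)"

quotient_type tword = "letter list" / "equivclp y_swap"
  by (rule equivp_evquivclp)

lemma y_swap_append_left: "y_swap a b \<Longrightarrow> y_swap (u @ a) (u @ b)"
  by (induction rule: y_swap.induct) (metis append.assoc y_swap.intros)

lemma y_swap_append_right: "y_swap a b \<Longrightarrow> y_swap (a @ v) (b @ v)"
  by (induction rule: y_swap.induct) (metis append.assoc y_swap.intros)

lemma equivclp_y_swap_map:
  assumes "\<And>a b. y_swap a b \<Longrightarrow> y_swap (f a) (f b)" and "equivclp y_swap a b"
  shows "equivclp y_swap (f a) (f b)"
  using assms(2)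
proof (induction rule: equivclp_induct)
  case base
  show ?case by simp
next
  case (step y z)
  then have "equivclp y_swap (f y) (f z)"
    using assms(1) by (blast intro: r_into_equivclp converse_r_into_equivclp)
  with step.IH show ?case by (rule equivclp_trans)
qed

instantiation tword :: monoid_add
begin

lift_definition zero_tword :: tword is "[]" .

lift_definition plus_tword :: "tword \<Rightarrow> tword \<Rightarrow> tword" is "(@)"
proof -
  fix a b c d :: "letter list"
  assume ab: "equivclp y_swap a b" and cd: "equivclp y_swap c d"
  have "equivclp y_swap (a @ c) (b @ c)"
    by (rule equivclp_y_swap_map[OF _ ab]) (rule y_swap_append_right)
  moreover have "equivclp y_swap (b @ c) (b @ d)"
    by (rule equivclp_y_swap_map[OF _ cd]) (rule y_swap_append_left)
  ultimately show "equivclp y_swap (a @ c) (b @ d)" by (rule equivclp_trans)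
qed

instance
  by standard (transfer, simp)+

end

type_synonym rt = "tword \<Rightarrow>\<^sub>0 int"

definition mono_of :: "letter list \<Rightarrow> rt" where
  "mono_of w = frag_of (abs_tword w)"

definition t_gen :: rt where
  "t_gen = mono_of [T]"

definition y_gen :: "nat \<Rightarrow> rt" where
  "y_gen i = mono_of [Y i]"

lemma mono_of_Nil: "mono_of [] = 1"
  by (simp add: mono_of_def zero_tword.abs_eq[symmetric])

lemma mono_of_append: "mono_of (u @ v) = mono_of u * mono_of v"
  by (simp add: mono_of_def mult_single plus_tword.abs_eq)

lemma mono_of_Cons: "mono_of (g # w) = mono_of [g] * mono_of w"
  using mono_of_append[of "[g]" w] by simp

lemma y_commute: "y_gen i * y_gen j = y_gen j * y_gen i"
proof -
  have "y_swap ([] @ [Y i, Y j] @ []) ([] @ [Y j, Y i] @ [])"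
    by (rule y_swap.intros)
  then have "abs_tword [Y i, Y j] = abs_tword [Y j, Y i]"
    by (auto simp: tword.abs_eq_iff)
  then show ?thesis
    using mono_of_append[of "[Y i]" "[Y j]"] mono_of_append[of "[Y j]" "[Y i]"]
    by (simp add: y_gen_def mono_of_def)
qed


text \<open>
  \<open>\<Delta>\<close> is forced on words by the Leibniz rule and extended additively; the lemmas
  \<open>Delta_*\<close> show that it is the unique derivation with the prescribed values.
\<close>

fun Delta_letter :: "letter \<Rightarrow> rt" where
  "Delta_letter T = 0"
| "Delta_letter (Y i) = y_gen (Suc i)"

fun Delta_list :: "letter list \<Rightarrow> rt" where
  "Delta_list [] = 0"
| "Delta_list (g # w) = Delta_letter g * mono_of w + mono_of [g] * Delta_list w"

lemma Delta_list_append: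
  "Delta_list (u @ v) = Delta_list u * mono_of v + mono_of u * Delta_list v"
proof (induction u)
  case Nil
  show ?case by (simp add: mono_of_Nil)
next
  case (Cons g u)
  then show ?case
    by (simp add: mono_of_append mono_of_Cons[of g u] algebra_simps)
qed

lift_definition Delta_tword :: "tword \<Rightarrow> rt" is Delta_list
proof -
  have swap: "Delta_list a = Delta_list b" if "y_swap a b" for a b
    using that
  proof (induction rule: y_swap.induct)
    case (1 u i j v)
    have *: "Delta_list [Y i, Y j] = Delta_list [Y j, Y i]" for i j
      by (simp add: mono_of_Nil y_gen_def[symmetric] y_commute add.commute)
    have **: "mono_of [Y i, Y j] = mono_of [Y j, Y i]" for i j
      using y_commute[of i j] by (simp add: y_gen_def mono_of_append[symmetric])
    show ?case
      by (simp only: Delta_list_append mono_of_append *[of i j] **[of i j])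
  qed
  fix a b
  assume "equivclp y_swap a b"
  then show "Delta_list a = Delta_list b"
    by (induction rule: equivclp_induct) (auto dest: swap)
qed

definition Delta :: "rt \<Rightarrow> rt" where
  "Delta = frag_extend Delta_tword"

definition is_derivation :: "(rt \<Rightarrow> rt) \<Rightarrow> bool" where
  "is_derivation D \<longleftrightarrow>
     (\<forall>u v. D (u + v) = D u + D v) \<and> (\<forall>u v. D (u * v) = D u * v + u * D v)"

lemma Delta_mono_of: "Delta (mono_of w) = Delta_list w"
  by (simp add: Delta_def mono_of_def Delta_tword.abs_eq)

lemma Delta_y: "Delta (y_gen i) = y_gen (Suc i)"
  by (simp add: y_gen_def Delta_mono_of mono_of_Nil)

lemma Delta_t: "Delta t_gen = 0"
  by (simp add: t_gen_def Delta_mono_of)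

lemma rt_induct:
  fixes u :: rt
  assumes "P 0" "\<And>w. P (mono_of w)" "\<And>u v. P u \<Longrightarrow> P v \<Longrightarrow> P (u - v)"
  shows "P u"
proof -
  have "Poly_Mapping.keys u \<subseteq> UNIV" by simp
  then show ?thesis
  proof (induction rule: frag_induction)
    case zero
    show ?case by (rule assms(1))
  next
    case (one x)
    obtain w where "x = abs_tword w"
      by (induction x rule: tword.abs_induct) blast
    then show ?case using assms(2)[of w] by (simp add: mono_of_def)
  next
    case (diff a b)
    then show ?case by (rule assms(3))
  qed
qed

lemma Delta_0: "Delta 0 = 0"
  by (simp add: Delta_def)

lemma Delta_add: "Delta (u + v) = Delta u + Delta v"
  by (simp add: Delta_def frag_extend_add)

lemma Delta_diff: "Delta (u - v) = Delta u - Delta v"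
  by (simp add: Delta_def frag_extend_diff)

lemma Delta_mult: "Delta (u * v) = Delta u * v + u * Delta v"
proof (induction u rule: rt_induct)
  case 1
  show ?case by (simp add: Delta_0)
next
  case (2 w)
  show ?case
  proof (induction v rule: rt_induct)
    case 1
    show ?case by (simp add: Delta_0)
  next
    case (2 w')
    show ?case
      by (simp add: mono_of_append[symmetric] Delta_mono_of Delta_list_append)
  next
    case (3 v v')
    then show ?case by (simp add: Delta_diff algebra_simps)
  qed
next
  case (3 u u')
  then show ?case by (simp add: Delta_diff algebra_simps)
qed

lemma Delta_is_derivation: "is_derivation Delta"
  by (simp add: is_derivation_def Delta_add Delta_mult)

lemma Delta_unique:
  assumes D: "is_derivation D" and Dy: "\<And>i. D (y_gen i) = y_gen (Suc i)" and Dt: "D t_gen = 0"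
  shows "D = Delta"
proof
  fix u
  have D_add: "D (a + b) = D a + D b" and D_mult: "D (a * b) = D a * b + a * D b" for a b
    using D by (auto simp: is_derivation_def)
  have D_0: "D 0 = 0" using D_add[of 0 0] by simp
  have D_1: "D 1 = 0" using D_mult[of 1 1] by simp
  have D_diff: "D (a - b) = D a - D b" for a b
    using D_add[of "a - b" b] by (simp add: algebra_simps)
  have D_letter: "D (mono_of [g]) = Delta_letter g" for g
    using Dy Dt by (cases g) (simp_all add: y_gen_def t_gen_def)
  show "D u = Delta u"
  proof (induction u rule: rt_induct)
    case 1
    show ?case by (simp add: D_0 Delta_0)
  next
    case (2 w)
    have "D (mono_of w) = Delta_list w"
    proof (induction w)
      case Nil
      show ?case by (simp add: mono_of_Nil D_1)
    next
      case (Cons g w)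
      then show ?case by (simp add: mono_of_Cons[of g w] D_mult D_letter)
    qed
    then show ?case by (simp add: Delta_mono_of)
  next
    case (3 u v)
    then show ?case by (simp add: D_diff Delta_diff)
  qed
qed


fun U :: "nat \<Rightarrow> nat \<Rightarrow> rt" where
  "U 0 d = 1"
| "U (Suc n) d = y_gen 0 * ((\<lambda>u. Delta u + u * t_gen) ^^ d) (U n d)"

definition is_partition :: "nat list \<Rightarrow> nat \<Rightarrow> bool" where
  "is_partition lam m \<longleftrightarrow> sorted_wrt (\<ge>) lam \<and> 0 \<notin> set lam \<and> sum_list lam = m"

text \<open>
  The word \<open>y\<^sub>0\<^bsup>a\<^esup> y\<^sub>\<lambda> t\<^bsup>k\<^esup>\<close>, a basis element of \<open>R\<langle>t\<rangle>\<close> over \<open>\<int>\<close>.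
\<close>

definition y_word :: "nat \<Rightarrow> nat list \<Rightarrow> nat \<Rightarrow> tword" where
  "y_word a lam k = abs_tword (replicate a (Y 0) @ map Y lam @ replicate k T)"

lemma frag_of_y_word: "frag_of (y_word a lam k) = y_gen 0 ^ a * prod_list (map y_gen lam) * t_gen ^ k"
proof -
  have rep: "mono_of (replicate m g) = mono_of [g] ^ m" for m g
    by (induction m) (simp_all add: mono_of_Nil mono_of_Cons[of g "replicate _ g"])
  have lam: "mono_of (map Y lam) = prod_list (map y_gen lam)"
    by (induction lam) (simp_all add: mono_of_Nil mono_of_Cons[of "Y _" "map Y _"] y_gen_def)
  show ?thesis
    by (simp add: y_word_def mono_of_def[symmetric] mono_of_append rep lam y_gen_def t_gen_def mult.assoc)
qed

text \<open>The exponent of \<open>t\<close> is \<open>k = nd - |\<lambda>|\<close>, so it is not a separate argument.\<close>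

definition c_coeff :: "nat \<Rightarrow> nat \<Rightarrow> nat list \<Rightarrow> int" where
  "c_coeff n d lam = Poly_Mapping.lookup (U n d) (y_word (n - length lam) lam (n * d - sum_list lam))"


definition falling :: "'a::comm_ring_1 \<Rightarrow> nat \<Rightarrow> 'a" where
  "falling q m = (\<Prod>i<m. q - of_nat i)"

definition nonzero_terms :: "'i set \<Rightarrow> ('i \<Rightarrow> nat) \<Rightarrow> nat multiset" where
  "nonzero_terms I f = filter_mset (\<lambda>x. x \<noteq> 0) (image_mset f (mset_set I))"

text \<open>
  Sequences \<open>i\<^sub>1, \<dots>, i\<^bsub>n-1\<^esub>\<close> and arrays are extensional functions on their index
  sets, so that distinct functions are distinct sequences and arrays.
\<close>

definition sequences :: "nat \<Rightarrow> nat list \<Rightarrow> (nat \<Rightarrow> nat) set" where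
  "sequences n lam = {i \<in> {1..n-1} \<rightarrow>\<^sub>E UNIV. nonzero_terms {1..n-1} i = mset lam}"

definition array_index :: "nat \<Rightarrow> (nat \<times> nat) set" where
  "array_index n = {(i, j). 1 \<le> j \<and> j < i \<and> i \<le> n}"

definition arrays :: "nat \<Rightarrow> (nat \<times> nat \<Rightarrow> nat) set" where
  "arrays n = array_index n \<rightarrow>\<^sub>E UNIV"

definition row_sum :: "(nat \<times> nat \<Rightarrow> nat) \<Rightarrow> nat \<Rightarrow> nat" where
  "row_sum a i = (\<Sum>j = 1..<i. a (i, j))"

definition col_sum :: "nat \<Rightarrow> (nat \<times> nat \<Rightarrow> nat) \<Rightarrow> nat \<Rightarrow> nat" where
  "col_sum n a j = (\<Sum>i = j + 1..n. a (i, j))"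

end

theory Submission
  imports Defs "HOL-Computational_Algebra.Formal_Power_Series"
begin

text \<open>
  Put \<open>D = \<Delta> + \<rho>\<^sub>t\<close>. Then \<open>U\<^bsub>n,d\<^esub>\<close> is the word \<open>y\<^sub>0 D\<^sup>d y\<^sub>0 D\<^sup>d \<dots> y\<^sub>0 D\<^sup>d\<close> applied to \<open>1\<close>. Because
  \<open>D (y\<^sub>i v) = y\<^bsub>i+1\<^esub> v + y\<^sub>i D v\<close>, every one of the \<open>n d\<close> operators either stops at some letter to
  its right and raises its index by one, or runs through to the right end and leaves a \<open>t\<close>
  there.

  The first formula reads the letters from left to right. Leaving out the outermost letter, the
  \<open>j\<close>-th one is reached by \<open>j d\<close> operators minus those that stopped earlier, and \<open>i\<^sub>j\<close> of these
  stop at it; this gives the product of binomial coefficients. Formally it is the Leibniz rule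
  \<open>D\<^sup>m (y\<^sub>0 v) = \<Sum>\<^sub>x (m choose x) y\<^sub>x D\<^bsup>m-x\<^esup> v\<close> (\<open>D_power_y0_mult\<close>), applied once per letter
  (\<open>D_power_U_expand\<close>). To read off a coefficient one must know when two words agree, which
  they do exactly when their indices agree up to order and their powers of \<open>t\<close> are equal
  (\<open>abs_tword_normal_eq_iff\<close>).

  The second formula is the first one with the binomial coefficients written as factorials:
  the product telescopes (\<open>prod_gbinomial_eq_falling\<close>), and the sequences excluded by the
  inequalities contribute zero (\<open>prod_gbinomial_eq_0\<close>).

  In the third formula, \<open>a\<^bsub>i,j\<^esub>\<close> is the number of operators of the \<open>i\<close>-th group that stop at the
  \<open>j\<close>-th letter, groups and letters being counted from the right; the \<open>d\<close> operators of
  the \<open>i\<close>-th group can be distributed accordingly in \<open>(d)\<^bsub>r\<^sub>i\<^esub> / \<Prod>\<^sub>j a\<^bsub>i,j\<^esub>!\<close> ways.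
  For given column sums, the sum over all arrays can be carried out one column at a time with Vandermonde's identity
  (\<open>sum_arrays_eq_prod_gbinomial\<close>). The result is the summand of the first formula for the
  reversed sequence of column sums.
\<close>

section \<open>The operator \<open>\<Delta> + \<rho>\<^sub>t\<close> and its powers\<close>

abbreviation D :: "rt \<Rightarrow> rt" where
  "D \<equiv> \<lambda>u. Delta u + u * t_gen"

lemma Delta_of_nat_mult: "Delta (of_nat c * u) = of_nat c * Delta u"
proof -
  have 1: "Delta 1 = 0"
    using Delta_mult[of 1 1] by simp
  have "Delta (of_nat c) = 0"
    by (induction c) (simp_all add: Delta_0 Delta_add 1)
  then show ?thesis
    by (simp add: Delta_mult)
qed

lemma D_add: "D (u + v) = D u + D v"
  and D_of_nat_mult: "D (of_nat c * u) = of_nat c * D u"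
  by (simp_all add: Delta_add Delta_of_nat_mult algebra_simps)

lemma D_y_mult: "D (y_gen i * v) = y_gen (Suc i) * v + y_gen i * D v"
  by (simp add: Delta_mult Delta_y algebra_simps)

lemma D_sum: "D (\<Sum>x\<in>A. f x) = (\<Sum>x\<in>A. D (f x))"
proof (induction A rule: infinite_finite_induct)
  case (insert x A)
  then show ?case
    by (simp only: sum.insert[OF insert.hyps] D_add)
qed (simp_all add: Delta_0)

text \<open>
  Pascal's rule in summed form: it is what turns one further application of a derivation into
  the next binomial expansion.
\<close>

lemma sum_binomial_Suc:
  fixes f :: "nat \<Rightarrow> nat \<Rightarrow> 'a::semiring_1"
  shows "(\<Sum>x\<le>Suc m. of_nat (Suc m choose x) * f x (Suc m - x)) =
         (\<Sum>x\<le>m. of_nat (m choose x) * (f (Suc x) (m - x) + f x (Suc (m - x))))"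
proof -
  have *: "(\<Sum>x\<le>m. of_nat (m choose Suc x) * f (Suc x) (m - x)) + f 0 (Suc m) =
        (\<Sum>x\<le>m. of_nat (m choose x) * f x (Suc (m - x)))" 
  proof -
    have "(\<Sum>x\<le>m. of_nat (m choose x) * f x (Suc (m - x))) =
          (\<Sum>x\<le>m. of_nat (m choose x) * f x (Suc m - x))"
      by (rule sum.cong) (auto simp: Suc_diff_le)
    also have "\<dots> = (\<Sum>x\<le>Suc m. of_nat (m choose x) * f x (Suc m - x))"
      by (simp add: binomial_eq_0)
    finally show ?thesis
      by (simp add: sum.atMost_Suc_shift add.commute del: sum.atMost_Suc)
  qed
  have "(\<Sum>x\<le>Suc m. of_nat (Suc m choose x) * f x (Suc m - x)) =
     (\<Sum>x\<le>m. of_nat (m choose x) * f (Suc x) (m - x)) +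
     ((\<Sum>x\<le>m. of_nat (m choose Suc x) * f (Suc x) (m - x)) + f 0 (Suc m))"
    by (simp add: sum.atMost_Suc_shift distrib_right sum.distrib ac_simps del: sum.atMost_Suc)
  then show ?thesis
    by (simp add: * distrib_left sum.distrib)
qed

text \<open>
  \<open>\<rho>\<^sub>t\<close> multiplies on the right, so it never meets a factor standing on the left, and
  \<open>D (y\<^sub>i v) = y\<^bsub>i+1\<^esub> v + y\<^sub>i D v\<close>. Each of the \<open>m\<close> operators therefore either raises the
  leading letter or passes on to \<open>v\<close>, and the binomial coefficient counts the choices.
\<close>

lemma D_power_y0_mult:
  "(D ^^ m) (y_gen 0 * v) = (\<Sum>x\<le>m. of_nat (m choose x) * (y_gen x * (D ^^ (m - x)) v))"
proof (induction m)
  case 0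
  show ?case by simp
next
  case (Suc m)
  have "(D ^^ Suc m) (y_gen 0 * v) = D (\<Sum>x\<le>m. of_nat (m choose x) * (y_gen x * (D ^^ (m - x)) v))"
    using Suc by simp
  also have "\<dots> = (\<Sum>x\<le>m. of_nat (m choose x) *
      (y_gen (Suc x) * (D ^^ (m - x)) v + y_gen x * (D ^^ Suc (m - x)) v))"
    by (simp only: D_sum D_of_nat_mult D_y_mult funpow.simps comp_apply)
  also have "\<dots> = (\<Sum>x\<le>Suc m. of_nat (Suc m choose x) * (y_gen x * (D ^^ (Suc m - x)) v))"
    by (rule sum_binomial_Suc[symmetric, of _ "\<lambda>x r. y_gen x * (D ^^ r) v"])
  finally show ?case .
qed

text \<open>
  The operators that pass the leading \<open>y\<^sub>0\<close> of \<open>U (Suc N) d\<close> join the \<open>d\<close> operators behind it.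
\<close>

lemma D_power_U_Suc:
  "(D ^^ m) (U (Suc N) d) =
   (\<Sum>x\<le>m. of_nat (m choose x) * (y_gen x * (D ^^ (m - x + d)) (U N d)))"
  by (simp only: U.simps D_power_y0_mult funpow_add comp_apply)

lemma mono_of_replicate_T: "mono_of (replicate m T) = t_gen ^ m"
  by (induction m) (simp_all add: mono_of_Nil mono_of_Cons[of T "replicate _ T"] t_gen_def)

lemma D_power_1: "(D ^^ m) 1 = mono_of (replicate m T)"
proof -
  have "Delta (t_gen ^ m) = 0" for m
    by (induction m) (use Delta_mult[of 1 1] in \<open>simp_all add: Delta_mult Delta_t\<close>)
  then have "(D ^^ m) 1 = t_gen ^ m"
    by (induction m) (simp_all add: power_commutes)
  then show ?thesis
    by (simp add: mono_of_replicate_T)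
qed

text \<open>
  The number of ways in which \<open>m\<close> operators in front of a row of letters \<open>y\<^sub>0\<close>, with \<open>d\<close> more
  operators after each letter, can raise the letters to the indices in the list, read from left
  to right:
  \<open>x\<close> of the operators available stop at the first letter, and the others go on together with
  the next \<open>d\<close>. If \<open>x > m\<close>, the truncated difference is harmless because \<open>m choose x = 0\<close>.
\<close>

fun weight :: "nat \<Rightarrow> nat \<Rightarrow> nat list \<Rightarrow> nat" where
  "weight d m [] = 1"
| "weight d m (x # xs) = (m choose x) * weight d (m - x + d) xs"

lemma y_gen_mult_of_nat_mono_of:
  "y_gen x * (of_nat c * mono_of w) = of_nat c * mono_of (Y x # w)"
proof -
  have "y_gen x * (of_nat c * mono_of w) = of_nat c * (y_gen x * mono_of w)"
    by (metis mult.assoc mult_of_nat_commute)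
  then show ?thesis
    by (simp add: mono_of_Cons[of "Y x" w] y_gen_def)
qed

text \<open>
  The indices of nonzero weight are bounded by the total number \<open>m + N d\<close> of operators, but at
  each letter by a different number. A common bound \<open>B\<close> keeps the index set a plain finite set of
  lists, which splits into heads and tails. Every operator that raises no letter contributes one
  \<open>t\<close>, which gives the exponent.
\<close>

lemma D_power_U_expand:
  assumes "m + N * d \<le> B"
  shows "(D ^^ m) (U N d) =
    (\<Sum>xs | set xs \<subseteq> {..B} \<and> length xs = N.
       of_nat (weight d m xs) * mono_of (map Y xs @ replicate (m + N * d - sum_list xs) T))"
  using assms
proof (induction N arbitrary: m)
  case 0
  have "{xs. set xs \<subseteq> {..B} \<and> length xs = 0} = {[]}" by auto
  then show ?case by (simp add: D_power_1)
next
  case (Suc N)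
  let ?L = "{xs. set xs \<subseteq> {..B} \<and> length xs = N}"
  let ?F = "\<lambda>xs. of_nat (weight d m xs) *
              mono_of (map Y xs @ replicate (m + Suc N * d - sum_list xs) T)"
  \<comment> \<open>Heads beyond \<open>m\<close> have weight zero, so the bound can be lowered from \<open>B\<close> to \<open>m\<close>.\<close>
  have vanish: "?F (x # xs) = 0" if "\<not> x \<le> m" for x xs
    using that by (simp add: binomial_eq_0)
  have step: "of_nat (m choose x) * (y_gen x * (D ^^ (m - x + d)) (U N d)) =
      (\<Sum>xs\<in>?L. ?F (x # xs))" if "x \<le> m" for x
  proof -
    have "m - x + d + N * d \<le> B"
      using Suc.prems by simp
    then have "of_nat (m choose x) * (y_gen x * (D ^^ (m - x + d)) (U N d)) =
      (\<Sum>xs\<in>?L. of_nat (m choose x) * (y_gen x * (of_nat (weight d (m - x + d) xs) *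
         mono_of (map Y xs @ replicate (m - x + d + N * d - sum_list xs) T))))"
      by (simp only: Suc.IH sum_distrib_left)
    also have "\<dots> = (\<Sum>xs\<in>?L. ?F (x # xs))"
    proof (rule sum.cong[OF refl])
      fix xs
      have "m + Suc N * d - sum_list (x # xs) = m - x + d + N * d - sum_list xs"
        using that by simp
      then show "of_nat (m choose x) * (y_gen x * (of_nat (weight d (m - x + d) xs) *
         mono_of (map Y xs @ replicate (m - x + d + N * d - sum_list xs) T))) = ?F (x # xs)"
        by (simp add: y_gen_mult_of_nat_mono_of mult.assoc)
    qed
    finally show ?thesis .
  qed
  have inj: "inj_on (\<lambda>(x, xs). x # xs) ({..B} \<times> ?L)"
    by (auto simp: inj_on_def)
  have "{xs. set xs \<subseteq> {..B} \<and> length xs = Suc N} = (\<lambda>(x, xs). x # xs) ` ({..B} \<times> ?L)"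
    by (auto simp: length_Suc_conv)
  then have "(\<Sum>xs | set xs \<subseteq> {..B} \<and> length xs = Suc N. ?F xs) =
      (\<Sum>p\<in>{..B} \<times> ?L. ?F (fst p # snd p))"
    by (simp only: sum.reindex[OF inj] case_prod_beta comp_def)
  also have "\<dots> = (\<Sum>x\<le>B. \<Sum>xs\<in>?L. ?F (x # xs))"
    by (simp add: sum.cartesian_product case_prod_beta)
  also have "\<dots> = (\<Sum>x\<le>m. \<Sum>xs\<in>?L. ?F (x # xs))"
  proof (rule sum.mono_neutral_right)
    show "{..m} \<subseteq> {..B}" using Suc.prems by auto
    show "\<forall>x\<in>{..B} - {..m}. (\<Sum>xs\<in>?L. ?F (x # xs)) = 0"
      by (intro ballI sum.neutral vanish) auto
  qed simp
  also have "\<dots> = (D ^^ m) (U (Suc N) d)"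
    unfolding D_power_U_Suc by (intro sum.cong refl step[symmetric]) auto
  finally show ?case ..
qed

section \<open>Normal forms of words and coefficients\<close>

text \<open>
  The multiset of letters is the invariant that separates different normal forms
  \<open>y\<^sub>\<lambda> t\<^sup>k\<close>.
\<close>

lemma mset_y_swap: "equivclp y_swap a b \<Longrightarrow> mset a = mset b"
proof (induction rule: equivclp_induct)
  case (step y z)
  moreover have "mset u = mset v" if "y_swap u v" for u v
    using that by cases (simp add: add_mset_commute)
  ultimately show ?case by metis
qed simp

lemma mono_of_move_Y: "mono_of (map Y us @ Y x # w) = mono_of (Y x # map Y us @ w)"
proof (induction us)
  case (Cons u us)
  have "mono_of (map Y (u # us) @ Y x # w) = mono_of [Y u] * mono_of (Y x # map Y us @ w)"
    using Cons by (simp add: mono_of_Cons[of "Y u" "map Y us @ Y x # w"])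
  also have "\<dots> = (y_gen u * y_gen x) * mono_of (map Y us @ w)"
    by (simp add: mono_of_Cons[of "Y x" "map Y us @ w"] y_gen_def mult.assoc)
  also have "\<dots> = (y_gen x * y_gen u) * mono_of (map Y us @ w)"
    by (simp only: y_commute)
  also have "\<dots> = mono_of (Y x # map Y (u # us) @ w)"
    by (simp add: mono_of_Cons[of "Y x" "Y u # map Y us @ w"]
       mono_of_Cons[of "Y u" "map Y us @ w"] y_gen_def mult.assoc)
  finally show ?case .
qed simp

lemma mono_of_permute: 
  assumes "mset xs = mset ys"
  shows "mono_of (map Y xs @ w) = mono_of (map Y ys @ w)"
  using assms
proof (induction xs arbitrary: ys)
  case (Cons x xs)
  obtain us vs where ys: "ys = us @ x # vs"
    using Cons.prems by (metis list.set_intros(1) set_mset_mset split_list)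
  with Cons.prems have "mset xs = mset (us @ vs)" by simp
  then have "mono_of (map Y xs @ w) = mono_of (map Y (us @ vs) @ w)"
    by (rule Cons.IH)
  then show ?case
    using mono_of_move_Y[of us x "map Y vs @ w"]
    by (simp add: ys mono_of_Cons[of "Y x" "map Y xs @ w"]
       mono_of_Cons[of "Y x" "map Y us @ map Y vs @ w"])
qed simp

lemma abs_tword_normal_eq_iff:
  "abs_tword (map Y xs @ replicate k T) = abs_tword (map Y ys @ replicate l T) \<longleftrightarrow>
   mset xs = mset ys \<and> k = l" (is "?L \<longleftrightarrow> ?R")
proof
  assume ?L
  then have *: "mset (map Y xs @ replicate k T) = mset (map Y ys @ replicate l T)"
    by (auto simp: tword.abs_eq_iff dest: mset_y_swap)
  have strip: "image_mset Y (mset zs) = {#g \<in># mset (map Y zs @ replicate j T). g \<noteq> T#}" for zs j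
  proof -
    have "{#g \<in># mset (map Y zs). g \<noteq> T#} = mset (map Y zs)"
      by (induction zs) auto
    moreover have "{#g \<in># mset (replicate j T). g \<noteq> T#} = {#}"
      by (induction j) auto
    ultimately show ?thesis by (simp del: mset_replicate)
  qed
  have "image_mset Y (mset xs) = image_mset Y (mset ys)"
    by (simp only: strip[of xs k] strip[of ys l] *)
  then have ms: "mset xs = mset ys"
    by (rule multiset.inj_map_strong[rotated]) simp
  then have "length (map Y xs) = length (map Y ys)"
    using mset_eq_length[OF ms] by simp
  moreover have "length (map Y xs @ replicate k T) = length (map Y ys @ replicate l T)"
    by (rule mset_eq_length[OF *])
  ultimately show ?R
    using ms by simp
next
  assume ?R
  then have "mono_of (map Y xs @ replicate k T) = mono_of (map Y ys @ replicate l T)"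
    using mono_of_permute[of xs ys "replicate k T"] by simp
  then show ?L
    unfolding mono_of_def by (metis lookup_single_eq lookup_single_not_eq zero_neq_one)
qed

lemma lookup_of_nat_mult_mono_of:
  "Poly_Mapping.lookup (of_nat c * mono_of w) v = (if abs_tword w = v then int c else 0)"
  by (induction c) (auto simp: mono_of_def distrib_right lookup_add lookup_single)

lemma finite_sequences: "finite (sequences n lam)"
proof (rule finite_subset)
  show "sequences n lam \<subseteq> {1..n-1} \<rightarrow>\<^sub>E {..sum_list lam}"
  proof
    fix i assume "i \<in> sequences n lam"
    then have ext: "i \<in> {1..n-1} \<rightarrow>\<^sub>E UNIV" and ms: "nonzero_terms {1..n-1} i = mset lam"
      by (auto simp: sequences_def)
    have "i j \<le> sum_list lam" if "j \<in> {1..n-1}" for j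
    proof (cases "i j = 0")
      case False
      then have "i j \<in># nonzero_terms {1..n-1} i"
        using that by (auto simp: nonzero_terms_def)
      then have "i j \<in> set lam"
        by (simp only: ms set_mset_mset)
      then show ?thesis
        by (simp add: member_le_sum_list)
    qed simp
    then show "i \<in> {1..n-1} \<rightarrow>\<^sub>E {..sum_list lam}"
      using ext by (auto simp: PiE_def)
  qed
qed (intro finite_PiE; simp)

text \<open>
  Different lists of indices give the same word exactly when they are rearrangements of each
  other, so the coefficient collects the weights of all arrangements of \<open>\<lambda>\<close> padded with zeros.
  The outermost letter \<open>y\<^sub>0\<close> has no operator in front of it: it keeps its index, and
  only \<open>n - 1\<close> positions remain.
\<close>

lemma c_coeff_eq_sum_weight:
  assumes "length lam \<le> N" "0 \<notin> set lam"
  shows "c_coeff (Suc N) d lam = (\<Sum>i\<in>sequences (Suc N) lam. int (weight d d (map i [1..<Suc N])))"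
proof -
  let ?n = "Suc N"
  define B where "B = ?n * d + sum_list lam"
  let ?L = "{xs. set xs \<subseteq> {..B} \<and> length xs = N}"
  let ?e = "\<lambda>xs. d + N * d - sum_list xs"
  let ?target = "replicate (?n - length lam) 0 @ lam"
  have target: "y_word (?n - length lam) lam (?n * d - sum_list lam) =
      abs_tword (map Y ?target @ replicate (?n * d - sum_list lam) T)"
    by (simp add: y_word_def)
  have "y_gen 0 * (of_nat w * mono_of (map Y xs @ v)) = of_nat w * mono_of (map Y (0 # xs) @ v)"
    for w xs v
    by (simp add: y_gen_mult_of_nat_mono_of)
  then have U: "U ?n d = (\<Sum>xs\<in>?L. of_nat (weight d d xs) *
                 mono_of (map Y (0 # xs) @ replicate (?e xs) T))"
    by (simp only: U.simps D_power_U_expand[of d N d B] B_def mult_Suc le_add1 sum_distrib_left)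
  have match: "abs_tword (map Y (0 # xs) @ replicate (?e xs) T) =
       abs_tword (map Y ?target @ replicate (?n * d - sum_list lam) T) \<longleftrightarrow>
       filter_mset (\<lambda>x. x \<noteq> 0) (mset xs) = mset lam" (is "_ \<longleftrightarrow> ?F xs = _") if len: "length xs = N" for xs
  proof -
    let ?z = "\<lambda>m. replicate_mset m (0::nat)"
    \<comment> \<open>The zeros of a list are determined by its length and its nonzero entries.\<close>
    have split: "mset ys = ?F ys + ?z (length ys - size (?F ys))" for ys :: "nat list"
    proof -
      have "mset ys = ?F ys + filter_mset (\<lambda>x. x = 0) (mset ys)"
        using multiset_partition[of "mset ys" "\<lambda>x. x \<noteq> 0"] by simp
      moreover have "filter_mset (\<lambda>x. x = 0) (mset ys) = ?z (count (mset ys) 0)"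
        by (simp add: filter_eq_replicate_mset)
      moreover have "length ys = size (?F ys) + size (filter_mset (\<lambda>x. x = 0) (mset ys))"
        using calculation(1) by (metis size_mset size_union)
      ultimately show ?thesis by simp
    qed
    have lam: "?F lam = mset lam"
      using assms(2) by (auto simp: filter_mset_eq_conv intro: ccontr)
    have "mset (0 # xs) = mset ?target \<longleftrightarrow> ?F xs = mset lam"
    proof
      assume "mset (0 # xs) = mset ?target"
      then have "?F (0 # xs) = ?F ?target" by metis
      also have "?F ?target = ?F lam"
        by (simp add: filter_mset_eq_conv)
      finally have "?F xs = ?F lam" by simp
      then show "?F xs = mset lam" by (simp only: lam)
    next
      assume F: "?F xs = mset lam"
      then have "mset xs = mset lam + ?z (N - length lam)"
        using split[of xs] len by simp
      then show "mset (0 # xs) = mset ?target"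
        using assms(1) by (simp add: Suc_diff_le)
    qed
    \<comment> \<open>The exponent of \<open>t\<close> depends on the list only through its sum, hence only on its multiset.\<close>
    moreover have "?e xs = ?n * d - sum_list lam" if "mset (0 # xs) = mset ?target"
    proof -
      have "sum_list (0 # xs) = sum_list ?target"
        using that by (metis sum_mset_sum_list)
      then show ?thesis by (simp add: sum_list_replicate)
    qed
    ultimately show ?thesis
      unfolding abs_tword_normal_eq_iff by blast
  qed
  have "c_coeff ?n d lam = (\<Sum>xs\<in>?L. if ?F xs = mset lam then int (weight d d xs) else 0)"
    unfolding c_coeff_def U target lookup_sum lookup_of_nat_mult_mono_of
    by (rule sum.cong[OF refl]) (use match in simp)
  also have "\<dots> = (\<Sum>xs\<in>{xs\<in>?L. ?F xs = mset lam}. int (weight d d xs))"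
    by (rule sum.inter_filter[symmetric]) (rule finite_lists_length_eq, simp)
  also have "\<dots> = (\<Sum>i\<in>sequences ?n lam. int (weight d d (map i [1..<?n])))"
  proof (rule sum.reindex_bij_witness[where
        i = "\<lambda>i. map i [1..<?n]" and j = "\<lambda>xs. \<lambda>j\<in>{1..N}. xs ! (j - 1)"])
    have nz: "nonzero_terms {1..?n-1} i = ?F (map i [1..<?n])" for i
    proof -
      have "mset_set {1..N} = mset [1..<?n]"
        by (metis atLeastLessThanSuc_atLeastAtMost mset_upt)
      then show ?thesis by (simp add: nonzero_terms_def)
    qed
    fix xs assume xs: "xs \<in> {xs\<in>?L. ?F xs = mset lam}"
    show *: "map (\<lambda>j\<in>{1..N}. xs ! (j - 1)) [1..<?n] = xs"
      using xs by (auto intro!: nth_equalityI simp del: upt_Suc)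
    show "(\<lambda>j\<in>{1..N}. xs ! (j - 1)) \<in> sequences ?n lam"
      using xs unfolding sequences_def mem_Collect_eq nz * by auto
    show "int (weight d d (map (\<lambda>j\<in>{1..N}. xs ! (j - 1)) [1..<?n])) = int (weight d d xs)"
      by (simp only: *)
  next
    fix i assume i: "i \<in> sequences ?n lam"
    then have ext: "i \<in> extensional {1..N}" and ms: "?F (map i [1..<?n]) = mset lam"
      by (auto simp: sequences_def PiE_def nonzero_terms_def simp flip: mset_upt atLeastLessThanSuc_atLeastAtMost)
    show "(\<lambda>j\<in>{1..N}. map i [1..<?n] ! (j - 1)) = i"
    proof
      fix j show "(\<lambda>j\<in>{1..N}. map i [1..<?n] ! (j - 1)) j = i j"
        using ext by (auto simp: extensional_def simp del: upt_Suc)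
    qed
    have "x \<le> B" if "x \<in> set (map i [1..<?n])" for x
    proof (cases "x = 0")
      case False
      then have "x \<in> set_mset (?F (map i [1..<?n]))"
        using that by (simp del: upt_Suc)
      then have "x \<le> sum_list lam"
        unfolding ms by (simp add: member_le_sum_list)
      then show ?thesis by (simp add: B_def)
    qed simp
    then show "map i [1..<?n] \<in> {xs\<in>?L. ?F xs = mset lam}"
      using ms by auto
  qed
  finally show ?thesis .
qed

text \<open>
  When the entries before position \<open>j\<close> are admissible, the number of operators that reach it is
  \<open>m + j d\<close> minus the entries before it. As soon as an entry is too large, its own
  binomial coefficient vanishes, so it does not matter that the later tops may become negative.
\<close>

lemma of_nat_weight:
  "(of_nat (weight d m xs) :: 'a::field_char_0) =
   (\<Prod>j<length xs. (of_nat (m + j * d) - (\<Sum>l<j. of_nat (xs ! l))) gchoose (xs ! j))"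
proof (induction d m xs rule: weight.induct)
  case (2 d m x xs)
  show ?case
  proof (cases "x \<le> m")
    case True
    then have *: "of_nat (m - x + d + j * d) - (\<Sum>l<j. of_nat (xs ! l)) =
        (of_nat (m + Suc j * d) - (\<Sum>l<Suc j. of_nat ((x # xs) ! l)) :: 'a)" for j
      by (simp add: sum.lessThan_Suc_shift of_nat_diff algebra_simps del: sum.lessThan_Suc)
    have "(of_nat (weight d m (x # xs)) :: 'a) =
       (of_nat m gchoose x) * of_nat (weight d (m - x + d) xs)"
      by (simp add: binomial_gbinomial)
    also have "\<dots> = (\<Prod>j<length (x # xs). (of_nat (m + j * d) -
       (\<Sum>l<j. of_nat ((x # xs) ! l))) gchoose ((x # xs) ! j))"
      unfolding "2.IH" *
      by (simp add: prod.lessThan_Suc_shift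
               del: prod.lessThan_Suc sum.lessThan_Suc of_nat_add of_nat_mult of_nat_Suc mult_Suc)
    finally show ?thesis .
  next
    case False
    then have "(of_nat m :: 'a) gchoose x = 0" "m choose x = 0"
      by (simp_all add: binomial_eq_0 flip: binomial_gbinomial)
    then show ?thesis
      by (simp add: prod.lessThan_Suc_shift del: prod.lessThan_Suc)
  qed
qed simp

lemma c_coeff_eq_sum_gbinomial:
  assumes "length lam \<le> n - 1" "0 \<notin> set lam" "n \<ge> 1"
  shows "(of_int (c_coeff n d lam) :: 'a::field_char_0) =
    (\<Sum>i\<in>sequences n lam.
       \<Prod>j = 1..n-1. (of_nat (j * d) - (\<Sum>l = 1..<j. of_nat (i l))) gchoose (i j))"
proof -
  obtain N where n: "n = Suc N"
    using assms(3) by (cases n) auto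
  have "(of_nat (weight d d (map i [1..<n])) :: 'a) =
     (\<Prod>j = 1..n-1. (of_nat (j * d) - (\<Sum>l = 1..<j. of_nat (i l))) gchoose (i j))" for i
  proof -
    have *: "(\<Sum>l = 1..<Suc j. of_nat (i l)) = (\<Sum>l<j. of_nat (map i [1..<n] ! l) :: 'a)" if "j < N" for j
      using that by (auto simp: n atLeastLessThanSuc_atLeastAtMost sum.atLeast1_atMost_eq simp del: upt_Suc
         intro!: sum.cong simp flip: lessThan_Suc_atMost)
    show ?thesis
      unfolding of_nat_weight One_nat_def prod.atLeast1_atMost_eq
    proof (rule prod.cong)
      fix j assume "j \<in> {..<n - Suc 0}"
      then have "j < N" by (simp add: n)
      with *[OF this, symmetric] show "(of_nat (d + j * d) - (\<Sum>l<j. of_nat (map i [Suc 0..<n] ! l)) gchoose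
          map i [Suc 0..<n] ! j) =
          (of_nat (Suc j * d) - (\<Sum>l = Suc 0..<Suc j. of_nat (i l)) gchoose i (Suc j) :: 'a)"
        by (simp add: n del: upt_Suc sum.op_ivl_Suc)
    qed (simp add: n)
  qed
  then show ?thesis
    using c_coeff_eq_sum_weight[of lam N d] assms by (simp add: n)
qed

section \<open>Triangular arrays with given column sums\<close>

lemma falling_eq_gbinomial: "falling (q :: 'a::field_char_0) m = fact m * (q gchoose m)"
  by (simp add: falling_def gbinomial_mult_fact atLeast0LessThan)

lemma falling_add: "falling q (m + r) = falling q m * falling (q - of_nat m) r"
  by (induction r) (simp_all add: falling_def algebra_simps)

text \<open>
  Vandermonde's identity with any number of summands. Generalized binomial coefficients make it
  available for arguments of any sign.
\<close>

lemma gbinomial_sum_eq_sum_prod: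
  fixes q :: "'i \<Rightarrow> 'a::field_char_0"
  assumes "finite I"
  shows "(\<Sum>b | b \<in> I \<rightarrow>\<^sub>E UNIV \<and> sum b I = c. \<Prod>i\<in>I. q i gchoose b i) = (\<Sum>i\<in>I. q i) gchoose c"
  using assms
proof (induction I arbitrary: c rule: finite_induct)
  case empty
  have "{b :: 'i \<Rightarrow> nat. b \<in> {} \<rightarrow>\<^sub>E UNIV \<and> sum b {} = c} = (if c = 0 then {\<lambda>_. undefined} else {})"
    by auto
  then show ?case by (cases c) simp_all
next
  case (insert x I)
  let ?S = "\<lambda>I c. {b :: 'i \<Rightarrow> nat. b \<in> I \<rightarrow>\<^sub>E UNIV \<and> sum b I = c}"
  have fin: "finite (?S I c)" for c
  proof (rule finite_subset)
    show "?S I c \<subseteq> I \<rightarrow>\<^sub>E {..c}"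
      using insert.hyps(1) by (auto simp: PiE_def member_le_sum)
  qed (use insert.hyps(1) in \<open>auto intro: finite_PiE\<close>)
  have "(\<Sum>b\<in>?S (insert x I) c. \<Prod>i\<in>insert x I. q i gchoose b i) =
        (\<Sum>(k, b)\<in>(SIGMA k:{0..c}. ?S I (c - k)). (q x gchoose k) * (\<Prod>i\<in>I. q i gchoose b i))"
  proof (rule sum.reindex_bij_witness[where i = "\<lambda>(k, b). b(x := k)" and j = "\<lambda>b. (b x, restrict b I)"])
    fix b assume b: "b \<in> ?S (insert x I) c"
    then show "(\<lambda>(k, b). b(x := k)) (b x, restrict b I) = b"
      by (auto simp: fun_eq_iff PiE_def extensional_def)
    show "(b x, restrict b I) \<in> (SIGMA k:{0..c}. ?S I (c - k))"
      using b insert.hyps by (auto simp: sum.insert)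
    show "(case (b x, restrict b I) of (k, b) \<Rightarrow> (q x gchoose k) * (\<Prod>i\<in>I. q i gchoose b i)) =
       (\<Prod>i\<in>insert x I. q i gchoose b i)"
      using insert.hyps by simp
  next
    fix p assume "p \<in> (SIGMA k:{0..c}. ?S I (c - k))"
    then obtain k b where p: "p = (k, b)" "k \<le> c" "b \<in> I \<rightarrow>\<^sub>E UNIV" "sum b I = c - k" by auto
    have eq: "sum (b(x := k)) I = sum b I"
      using insert.hyps by (intro sum.cong) auto
    show "((\<lambda>(k, b). b(x := k)) p x, restrict ((\<lambda>(k, b). b(x := k)) p) I) = p"
      using p insert.hyps by (auto simp: fun_eq_iff PiE_def extensional_def)
    show "(\<lambda>(k, b). b(x := k)) p \<in> ?S (insert x I) c"
      using p insert.hyps eq by (auto simp: PiE_def extensional_def)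
  qed
  also have "\<dots> = (\<Sum>k=0..c. \<Sum>b\<in>?S I (c - k). (q x gchoose k) * (\<Prod>i\<in>I. q i gchoose b i))"
    by (rule sum.Sigma[symmetric]) (simp_all add: fin)
  also have "\<dots> = (\<Sum>k=0..c. (q x gchoose k) * (sum q I gchoose (c - k)))"
    by (simp only: sum_distrib_left[symmetric] insert.IH)
  also have "\<dots> = (\<Sum>i\<in>insert x I. q i) gchoose c"
    using insert.hyps by (simp add: gbinomial_Vandermonde)
  finally show ?case .
qed

text \<open>
  The index set of the first \<open>J\<close> columns of a triangular array, on which one can induct over the
  number of columns.
\<close>

definition cells :: "nat \<Rightarrow> nat \<Rightarrow> (nat \<times> nat) set" where
  "cells n J = {(i, j). 1 \<le> j \<and> j \<le> J \<and> j < i \<and> i \<le> n}"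

definition arrays_with_col_sums :: "nat \<Rightarrow> nat \<Rightarrow> (nat \<Rightarrow> nat) \<Rightarrow> (nat \<times> nat \<Rightarrow> nat) set" where
  "arrays_with_col_sums n J c = {a \<in> cells n J \<rightarrow>\<^sub>E UNIV. \<forall>j\<in>{1..J}. col_sum n a j = c j}"

lemma finite_cells: "finite (cells n J)"
  by (rule finite_subset[of _ "{..n} \<times> {..J}"]) (auto simp: cells_def)

lemma cells_Suc: "cells n (Suc J) = cells n J \<union> (\<lambda>i. (i, Suc J)) ` {Suc J + 1..n}"
  by (auto simp: cells_def le_Suc_eq image_iff)

lemma finite_arrays_with_col_sums: "finite (arrays_with_col_sums n J c)"
proof (rule finite_subset)
  show "arrays_with_col_sums n J c \<subseteq> (\<Pi>\<^sub>E p\<in>cells n J. {..c (snd p)})"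
  proof
    fix a assume a: "a \<in> arrays_with_col_sums n J c"
    have "a (i, j) \<le> c j" if "(i, j) \<in> cells n J" for i j
    proof -
      have "a (i, j) \<le> (\<Sum>i = j + 1..n. a (i, j))"
        using that by (intro member_le_sum) (auto simp: cells_def)
      with a that show ?thesis
        by (auto simp: arrays_with_col_sums_def col_sum_def cells_def)
    qed
    with a show "a \<in> (\<Pi>\<^sub>E p\<in>cells n J. {..c (snd p)})"
      by (auto simp: arrays_with_col_sums_def PiE_def)
  qed
qed (intro finite_PiE finite_cells; simp)

definition column :: "nat \<Rightarrow> nat \<Rightarrow> nat \<Rightarrow> (nat \<Rightarrow> nat) set" where
  "column n J c = {b. b \<in> {J + 1..n} \<rightarrow>\<^sub>E UNIV \<and> sum b {J + 1..n} = c}"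

text \<open>
  Columns are appended on the right, where they are shortest: all rows of column \<open>J + 1\<close> are
  present in the columns before it.
\<close>

definition add_column :: "nat \<Rightarrow> nat \<Rightarrow> (nat \<Rightarrow> nat) \<Rightarrow> (nat \<times> nat \<Rightarrow> nat) \<Rightarrow> nat \<times> nat \<Rightarrow> nat" where
  "add_column n J b a = (\<lambda>(i, j)\<in>cells n (Suc J). if j = Suc J then b i else a (i, j))"

lemma sum_arrays_Suc:
  fixes F :: "_ \<Rightarrow> 'a::comm_monoid_add"
  shows "(\<Sum>a\<in>arrays_with_col_sums n (Suc J) c. F a) =
   (\<Sum>b\<in>column n (Suc J) (c (Suc J)). \<Sum>a\<in>arrays_with_col_sums n J c. F (add_column n J b a))"
proof -
  let ?C = "column n (Suc J) (c (Suc J))"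
  have "(\<Sum>a\<in>arrays_with_col_sums n (Suc J) c. F a) =
        (\<Sum>(b, a)\<in>?C \<times> arrays_with_col_sums n J c. F (add_column n J b a))"
  proof (rule sum.reindex_bij_witness[where i = "\<lambda>(b, a). add_column n J b a" and
         j = "\<lambda>a. (\<lambda>i\<in>{Suc J + 1..n}. a (i, Suc J), restrict a (cells n J))"])
    fix a assume a: "a \<in> arrays_with_col_sums n (Suc J) c"
    then have ext: "a \<in> extensional (cells n (Suc J))" and
      cs: "\<And>j. j \<in> {1..Suc J} \<Longrightarrow> col_sum n a j = c j"
      by (auto simp: arrays_with_col_sums_def PiE_def)
    have "add_column n J (\<lambda>i\<in>{Suc J + 1..n}. a (i, Suc J)) (restrict a (cells n J)) = a"
      using ext by (auto simp: add_column_def fun_eq_iff restrict_def cells_def extensional_def)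
    then show "(\<lambda>(b, a). add_column n J b a) (\<lambda>i\<in>{Suc J + 1..n}. a (i, Suc J), restrict a (cells n J)) = a"
      and "(case (\<lambda>i\<in>{Suc J + 1..n}. a (i, Suc J), restrict a (cells n J)) of
         (b, a) \<Rightarrow> F (add_column n J b a)) = F a"
      by simp_all
    have "col_sum n (restrict a (cells n J)) j = c j" if "j \<in> {1..J}" for j
    proof -
      have "col_sum n (restrict a (cells n J)) j = col_sum n a j"
        unfolding col_sum_def using that by (intro sum.cong) (auto simp: cells_def)
      then show ?thesis using cs[of j] that by simp
    qed
    then show "(\<lambda>i\<in>{Suc J + 1..n}. a (i, Suc J), restrict a (cells n J)) \<in> ?C \<times> arrays_with_col_sums n J c"
      using cs[of "Suc J"] by (auto simp: column_def arrays_with_col_sums_def col_sum_def)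
  next
    fix p assume p: "p \<in> ?C \<times> arrays_with_col_sums n J c"
    obtain b a where p_eq: "p = (b, a)" by (cases p)
    have b: "b \<in> {Suc J + 1..n} \<rightarrow>\<^sub>E UNIV" "sum b {Suc J + 1..n} = c (Suc J)"
      and a: "a \<in> extensional (cells n J)" and cs: "\<And>j. j \<in> {1..J} \<Longrightarrow> col_sum n a j = c j"
      using p unfolding p_eq by (auto simp: column_def arrays_with_col_sums_def PiE_def)
    have "col_sum n (add_column n J b a) j = c j" if "j \<in> {1..Suc J}" for j
    proof (cases "j = Suc J")
      case True
      have "col_sum n (add_column n J b a) j = sum b {Suc J + 1..n}"
        unfolding col_sum_def True by (intro sum.cong) (auto simp: cells_def add_column_def)
      then show ?thesis using b(2) by (simp add: True)
    next
      case False
      have "col_sum n (add_column n J b a) j = col_sum n a j"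
        unfolding col_sum_def using that False by (intro sum.cong) (auto simp: cells_def add_column_def)
      then show ?thesis using cs[of j] that False by simp
    qed
    then show "(\<lambda>(b, a). add_column n J b a) p \<in> arrays_with_col_sums n (Suc J) c"
      by (auto simp: p_eq arrays_with_col_sums_def add_column_def)
    have 1: "(\<lambda>i\<in>{Suc J + 1..n}. add_column n J b a (i, Suc J)) = b"
      using b(1) by (auto simp: fun_eq_iff add_column_def cells_def PiE_def extensional_def)
    have 2: "restrict (add_column n J b a) (cells n J) = a"
      using a by (auto simp: fun_eq_iff add_column_def cells_def extensional_def restrict_def)
    show "(\<lambda>i\<in>{Suc J + 1..n}. (\<lambda>(b, a). add_column n J b a) p (i, Suc J),
       restrict ((\<lambda>(b, a). add_column n J b a) p) (cells n J)) = p"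
      by (simp only: p_eq prod.case 1 2)
  qed
  then show ?thesis
    by (simp add: sum.cartesian_product)
qed

text \<open>
  Remove the last column \<open>b\<close>. Row by row
  \<open>(q\<^sub>i)\<^bsub>b\<^sub>i + r\<^sub>i\<^esub> = (q\<^sub>i)\<^bsub>b\<^sub>i\<^esub> (q\<^sub>i - b\<^sub>i)\<^bsub>r\<^sub>i\<^esub>\<close>, so the other columns see the same sum with the
  parameters \<open>q\<^sub>i - b\<^sub>i\<close>. Their sum depends only on the totals of these parameters over the rows
  of each column, and thus on \<open>b\<close> only through its prescribed sum; what remains is
  Vandermonde's identity for the column \<open>b\<close>. The induction needs parameters \<open>q\<^sub>i\<close>
  that differ from row to row, and they are arbitrary field elements so that no
  difference has to be nonnegative.
\<close>

lemma sum_arrays_eq_prod_gbinomial: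
  fixes q :: "nat \<Rightarrow> 'a::field_char_0"
  shows "(\<Sum>a\<in>arrays_with_col_sums n J c.
            (\<Prod>i = 2..n. falling (q i) (\<Sum>j | 1 \<le> j \<and> j \<le> J \<and> j < i. a (i, j))) / (\<Prod>p\<in>cells n J. fact (a p))) =
         (\<Prod>j = 1..J. ((\<Sum>i = j + 1..n. q i) - (\<Sum>l = j + 1..J. of_nat (c l))) gchoose c j)"
proof (induction J arbitrary: q)
  case 0
  have cells: "cells n 0 = {}"
    by (auto simp: cells_def)
  then have arrays: "arrays_with_col_sums n 0 c = {\<lambda>_. undefined}"
    by (simp add: arrays_with_col_sums_def)
  have row: "(\<Sum>j | 1 \<le> j \<and> j \<le> 0 \<and> j < i. a (i, j)) = 0" for a :: "nat \<times> nat \<Rightarrow> nat" and i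
    by (rule sum.neutral) auto
  show ?case
    unfolding arrays cells row by (simp add: falling_def)
next
  case (Suc J)
  let ?R = "{Suc J + 1..n}"
  let ?r = "\<lambda>J a i. \<Sum>j | 1 \<le> j \<and> j \<le> J \<and> j < i. a (i, j)"
  let ?f = "\<lambda>q J a. (\<Prod>i = 2..n. falling (q i) (?r J a i)) / (\<Prod>p\<in>cells n J. fact (a p)) :: 'a"
  let ?g = "\<lambda>j. ((\<Sum>i = j + 1..n. q i) - (\<Sum>l = j + 1..Suc J. of_nat (c l))) gchoose c j"
  define q' where "q' b i = (if i \<in> ?R then q i - of_nat (b i) else q i)" for b :: "nat \<Rightarrow> nat" and i
  have f: "?f q (Suc J) (add_column n J b a) = (\<Prod>i\<in>?R. q i gchoose b i) * ?f (q' b) J a" for a b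
  proof -
    let ?a = "add_column n J b a"
    have row: "falling (q i) (?r (Suc J) ?a i) =
       (if i \<in> ?R then falling (q i) (b i) else 1) * falling (q' b i) (?r J a i)" if "i \<in> {2..n}" for i
    proof (cases "i \<in> ?R")
      case True
      have "{j. 1 \<le> j \<and> j \<le> Suc J \<and> j < i} = insert (Suc J) {j. 1 \<le> j \<and> j \<le> J \<and> j < i}"
        using True by auto
      moreover have "finite {j. 1 \<le> j \<and> j \<le> J \<and> j < i}"
        by (rule finite_subset[of _ "{..J}"]) auto
      ultimately have "?r (Suc J) ?a i = ?a (i, Suc J) + (\<Sum>j | 1 \<le> j \<and> j \<le> J \<and> j < i. ?a (i, j))"
        by simp
      also have "\<dots> = b i + ?r J a i"
        using True by (intro arg_cong2[where f = "(+)"] sum.cong) (auto simp: add_column_def cells_def)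
      finally show ?thesis
        using True by (simp only: falling_add q'_def if_True)
    next
      case False
      have "?r (Suc J) ?a i = ?r J a i"
        using that False by (intro sum.cong) (auto simp: add_column_def cells_def)
      then show ?thesis
        using False by (simp only: q'_def if_False mult_1)
    qed
    have "(\<Prod>i = 2..n. falling (q i) (?r (Suc J) ?a i)) =
        (\<Prod>i = 2..n. if i \<in> ?R then falling (q i) (b i) else 1) * (\<Prod>i = 2..n. falling (q' b i) (?r J a i))"
      by (simp only: row prod.distrib cong: prod.cong)
    also have "(\<Prod>i = 2..n. if i \<in> ?R then falling (q i) (b i) else 1) = (\<Prod>i\<in>?R. falling (q i) (b i))"
      by (subst prod.inter_restrict[symmetric]) (auto intro!: prod.cong)
    finally have num: "(\<Prod>i = 2..n. falling (q i) (?r (Suc J) ?a i)) =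
        (\<Prod>i\<in>?R. falling (q i) (b i)) * (\<Prod>i = 2..n. falling (q' b i) (?r J a i))" .
    have "(\<Prod>p\<in>cells n (Suc J). fact (?a p) :: 'a) =
       (\<Prod>p\<in>cells n J. fact (?a p)) * (\<Prod>p\<in>(\<lambda>i. (i, Suc J)) ` ?R. fact (?a p))"
      unfolding cells_Suc by (intro prod.union_disjoint finite_cells) (auto simp: cells_def)
    also have "(\<Prod>p\<in>cells n J. fact (?a p) :: 'a) = (\<Prod>p\<in>cells n J. fact (a p))"
      by (intro prod.cong) (auto simp: cells_def add_column_def)
    also have "(\<Prod>p\<in>(\<lambda>i. (i, Suc J)) ` ?R. fact (?a p) :: 'a) = (\<Prod>i\<in>?R. fact (b i))"
      by (subst prod.reindex) (auto simp: inj_on_def cells_def add_column_def intro!: prod.cong)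
    finally have den: "(\<Prod>p\<in>cells n (Suc J). fact (?a p) :: 'a) =
       (\<Prod>p\<in>cells n J. fact (a p)) * (\<Prod>i\<in>?R. fact (b i))" .
    have "(\<Prod>i\<in>?R. q i gchoose b i) = (\<Prod>i\<in>?R. falling (q i) (b i)) / (\<Prod>i\<in>?R. fact (b i))"
      by (simp add: falling_eq_gbinomial flip: prod_dividef)
    then show ?thesis
      unfolding num den by simp
  qed
  \<comment> \<open>All rows of the removed column lie in every earlier column \<open>j\<close>, so its total is subtracted
    once from each of them.\<close>
  have q': "(\<Sum>i = j + 1..n. q' b i) - (\<Sum>l = j + 1..J. of_nat (c l)) =
        (\<Sum>i = j + 1..n. q i) - (\<Sum>l = j + 1..Suc J. of_nat (c l))"
    if b: "b \<in> column n (Suc J) (c (Suc J))" and j: "j \<in> {1..J}" for b j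
  proof -
    have "(\<Sum>i = j + 1..n. q' b i) = (\<Sum>i = j + 1..n. q i - (if i \<in> ?R then of_nat (b i) else 0))"
      by (intro sum.cong) (auto simp: q'_def)
    also have "\<dots> = (\<Sum>i = j + 1..n. q i) - (\<Sum>i = j + 1..n. if i \<in> ?R then of_nat (b i) else 0)"
      by (rule sum_subtractf)
    also have "(\<Sum>i = j + 1..n. if i \<in> ?R then of_nat (b i) else 0) = (\<Sum>i\<in>?R. of_nat (b i) :: 'a)"
      using j by (subst sum.inter_restrict[symmetric]) (auto intro!: sum.cong)
    also have "\<dots> = of_nat (c (Suc J))"
      using b by (simp add: column_def flip: of_nat_sum)
    finally show ?thesis
      using j by simp
  qed
  have "(\<Sum>a\<in>arrays_with_col_sums n (Suc J) c. ?f q (Suc J) a) =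
    (\<Sum>b\<in>column n (Suc J) (c (Suc J)). (\<Prod>i\<in>?R. q i gchoose b i) * (\<Sum>a\<in>arrays_with_col_sums n J c. ?f (q' b) J a))"
    unfolding sum_arrays_Suc f sum_distrib_left ..
  also have "\<dots> = (\<Sum>b\<in>column n (Suc J) (c (Suc J)). (\<Prod>i\<in>?R. q i gchoose b i) * (\<Prod>j = 1..J. ?g j))"
    unfolding Suc.IH by (intro sum.cong refl arg_cong2[where f = "(*)"] prod.cong) (simp only: q')
  also have "\<dots> = (sum q ?R gchoose c (Suc J)) * (\<Prod>j = 1..J. ?g j)"
    unfolding sum_distrib_right[symmetric] column_def
    by (subst gbinomial_sum_eq_sum_prod) simp_all
  also have "\<dots> = (\<Prod>j = 1..Suc J. ?g j)"
    by (simp add: mult.commute)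
  finally show ?case .
qed

section \<open>Telescoping into falling factorials\<close>

lemma falling_of_nat_add: "falling (of_nat (m + d) :: 'a::field_char_0) d = fact (m + d) / fact m"
proof -
  have "(of_nat (m + d) gchoose d :: 'a) = fact (m + d) / (fact d * fact m)"
    by (simp only: binomial_gbinomial[symmetric] binomial_fact[OF le_add2] add_diff_cancel_right')
  then show ?thesis
    by (simp add: falling_eq_gbinomial)
qed

text \<open>
  Write \<open>A\<^sub>j = j d - i\<^sub>1 - \<dots> - i\<^bsub>j-1\<^esub>\<close>. Since \<open>A\<^sub>j - i\<^sub>j = A\<^bsub>j+1\<^esub> - d\<close>, the product of the
  quotients \<open>A\<^sub>j! / (i\<^sub>j! (A\<^sub>j - i\<^sub>j)!)\<close> telescopes: each \<open>A\<^sub>j!\<close> over the preceding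
  \<open>(A\<^sub>j - d)!\<close> is a falling factorial of length \<open>d\<close>, and \<open>(A\<^bsub>N+1\<^esub> - d)!\<close> is left over.
\<close>

lemma prod_gbinomial_eq_falling:
  fixes i :: "nat \<Rightarrow> nat"
  assumes "\<forall>j\<in>{1..N}. (\<Sum>l = 1..j. i l) \<le> j * d"
  shows "(\<Prod>j = 1..N. (of_nat (j * d) - (\<Sum>l = 1..<j. of_nat (i l)) :: 'a::field_char_0) gchoose (i j)) =
    1 / fact (N * d - (\<Sum>l = 1..N. i l)) * (1 / (\<Prod>j = 1..N. fact (i j))) *
    (\<Prod>j = 1..N. falling (of_nat (j * d) - (\<Sum>l = 1..<j. of_nat (i l))) d)"
  using assms
proof (induction N)
  case (Suc N)
  define s where "s = (\<Sum>l = 1..N. i l)"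
  define b where "b = N * d - s"
  have sN: "s \<le> N * d"
    using Suc.prems by (cases "N = 0") (auto simp: s_def)
  have "s + i (Suc N) \<le> Suc N * d"
    using Suc.prems[rule_format, of "Suc N"] by (simp add: s_def)
  then have ib: "i (Suc N) \<le> b + d"
    using sN by (simp add: b_def)
  have top: "of_nat (Suc N * d) - (\<Sum>l = 1..<Suc N. of_nat (i l)) = (of_nat (b + d) :: 'a)"
    using sN by (simp add: b_def s_def of_nat_diff atLeastLessThanSuc_atLeastAtMost
        del: sum.op_ivl_Suc flip: of_nat_sum)
  have bottom: "Suc N * d - (\<Sum>l = 1..Suc N. i l) = b + d - i (Suc N)"
    using sN by (simp add: b_def s_def)
  have g: "(of_nat (b + d) gchoose i (Suc N) :: 'a) = fact (b + d) / (fact (i (Suc N)) * fact (b + d - i (Suc N)))"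
    by (simp only: binomial_gbinomial[symmetric] binomial_fact[OF ib])
  have IH: "(\<Prod>j = 1..N. (of_nat (j * d) - (\<Sum>l = 1..<j. of_nat (i l)) :: 'a) gchoose (i j)) =
    1 / fact b * (1 / (\<Prod>j = 1..N. fact (i j))) *
    (\<Prod>j = 1..N. falling (of_nat (j * d) - (\<Sum>l = 1..<j. of_nat (i l))) d)"
    unfolding b_def s_def using Suc by simp
  have split: "prod f {1..Suc N} = prod f {1..N} * f (Suc N)" for f :: "nat \<Rightarrow> 'a"
    by simp
  show ?case
    unfolding split bottom top IH g falling_of_nat_add by (simp add: field_simps)
qed simp

text \<open>
  At the first violated inequality, the top of the binomial coefficient is still a natural
  number, but it is smaller than the bottom.
\<close>

lemma prod_gbinomial_eq_0:
  fixes i :: "nat \<Rightarrow> nat"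
  assumes "\<not> (\<forall>j\<in>{1..N}. (\<Sum>l = 1..j. i l) \<le> j * d)"
  shows "(\<Prod>j = 1..N. (of_nat (j * d) - (\<Sum>l = 1..<j. of_nat (i l)) :: 'a::field_char_0) gchoose (i j)) = 0"
proof -
  define P where "P j \<longleftrightarrow> j \<in> {1..N} \<and> \<not> (\<Sum>l = 1..j. i l) \<le> j * d" for j
  define j where "j = (LEAST j. P j)"
  have "\<exists>j. P j" using assms by (auto simp: P_def)
  then have "P j" and least: "\<And>j'. j' < j \<Longrightarrow> \<not> P j'"
    unfolding j_def by (auto intro: LeastI dest: not_less_Least)
  then obtain k where j: "j = Suc k" "Suc k \<le> N" and big: "\<not> (\<Sum>l = 1..Suc k. i l) \<le> Suc k * d"
    by (cases j) (auto simp: P_def)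
  define s where "s = (\<Sum>l = 1..k. i l)"
  have "s \<le> k * d"
    using least[of k] j by (cases "k = 0") (auto simp: P_def s_def)
  then have sk: "s \<le> Suc k * d" by simp
  have "of_nat (j * d) - (\<Sum>l = 1..<j. of_nat (i l)) = (of_nat (Suc k * d - s) :: 'a)"
    using sk by (simp add: j s_def of_nat_diff atLeastLessThanSuc_atLeastAtMost
        del: sum.op_ivl_Suc mult_Suc flip: of_nat_sum)
  moreover have "Suc k * d - s < i j"
    using big sk by (simp add: j s_def)
  ultimately have "(of_nat (j * d) - (\<Sum>l = 1..<j. of_nat (i l)) :: 'a) gchoose (i j) = 0"
    by (simp add: binomial_eq_0 del: mult_Suc of_nat_mult flip: binomial_gbinomial)
  moreover have "j \<in> {1..N}" using j by simp
  ultimately show ?thesis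
    by (meson finite_atLeastAtMost prod_zero)
qed

lemma prod_fact_nonzero_terms:
  assumes "nonzero_terms I f = mset lam" 
  shows "(\<Prod>i\<in>I. fact (f i)) = (\<Prod>p\<leftarrow>lam. fact p :: 'a::field_char_0)"
proof -
  have "prod_mset (image_mset fact (filter_mset (\<lambda>x. x \<noteq> 0) M)) = (prod_mset (image_mset fact M) :: 'a)" for M
    by (induction M) auto
  then have "(\<Prod>i\<in>I. fact (f i) :: 'a) = prod_mset (image_mset fact (mset lam))"
    unfolding assms[symmetric] nonzero_terms_def
    by (simp add: prod_unfold_prod_mset multiset.map_comp comp_def)
  then show ?thesis
    by (simp add: prod_mset_prod_list flip: mset_map)
qed

lemma sum_nonzero_terms:
  assumes "nonzero_terms I f = mset lam" 
  shows "(\<Sum>i\<in>I. f i) = sum_list lam"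
proof -
  have "sum_mset (filter_mset (\<lambda>x. x \<noteq> 0) M) = sum_mset M" for M :: "nat multiset"
    by (induction M) auto
  then have "(\<Sum>i\<in>I. f i) = sum_mset (mset lam)"
    unfolding assms[symmetric] nonzero_terms_def by (simp add: sum_unfold_sum_mset)
  then show ?thesis
    by (simp add: sum_mset_sum_list)
qed

lemma sum_gbinomial_eq_sum_falling:
  "(\<Sum>i\<in>sequences n lam.
       \<Prod>j = 1..n-1. (of_nat (j * d) - (\<Sum>l = 1..<j. of_nat (i l)) :: 'a::field_char_0) gchoose (i j)) =
    1 / fact ((n - 1) * d - sum_list lam) * (1 / (\<Prod>p\<leftarrow>lam. fact p)) *
       (\<Sum>i\<in>{i \<in> sequences n lam. \<forall>j\<in>{1..n-1}. (\<Sum>l = 1..j. i l) \<le> j * d}.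
          \<Prod>j = 1..n-1. falling (of_nat (j * d) - (\<Sum>l = 1..<j. of_nat (i l))) d)"
proof -
  let ?S = "{i \<in> sequences n lam. \<forall>j\<in>{1..n-1}. (\<Sum>l = 1..j. i l) \<le> j * d}"
  let ?g = "\<lambda>i. \<Prod>j = 1..n-1. (of_nat (j * d) - (\<Sum>l = 1..<j. of_nat (i l)) :: 'a) gchoose (i j)"
  have "(\<Sum>i\<in>sequences n lam. ?g i) = (\<Sum>i\<in>?S. ?g i)"
    by (rule sum.mono_neutral_right) (use prod_gbinomial_eq_0 in \<open>auto simp: finite_sequences\<close>)
  also have "\<dots> = (\<Sum>i\<in>?S. 1 / fact ((n - 1) * d - sum_list lam) * (1 / (\<Prod>p\<leftarrow>lam. fact p)) *
       (\<Prod>j = 1..n-1. falling (of_nat (j * d) - (\<Sum>l = 1..<j. of_nat (i l))) d))"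
  proof (rule sum.cong[OF refl])
    fix i assume i: "i \<in> ?S"
    then have nz: "nonzero_terms {1..n-1} i = mset lam"
      by (simp add: sequences_def)
    show "?g i = 1 / fact ((n - 1) * d - sum_list lam) * (1 / (\<Prod>p\<leftarrow>lam. fact p)) *
       (\<Prod>j = 1..n-1. falling (of_nat (j * d) - (\<Sum>l = 1..<j. of_nat (i l))) d)"
      using prod_gbinomial_eq_falling[of "n - 1" i d, where 'a = 'a] i
      unfolding sum_nonzero_terms[OF nz] prod_fact_nonzero_terms[OF nz] by blast
  qed
  finally show ?thesis
    by (simp only: sum_distrib_left)
qed

section \<open>Arrays and sequences\<close>

lemma array_index_eq_cells: "array_index n = cells n (n - 1)"
  by (auto simp: array_index_def cells_def)

text \<open>
  Column \<open>j\<close> of an array belongs to the \<open>j\<close>-th letter from the right, whereas sequences list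
  the letters from the left.
\<close>

lemma sum_sequences_reverse:
  "(\<Sum>i\<in>sequences n lam. F i) = (\<Sum>c\<in>sequences n lam. F (\<lambda>j\<in>{1..n-1}. c (n - j)))"
proof -
  let ?rev = "\<lambda>c. \<lambda>j\<in>{1..n-1}. c (n - j)"
  have rev_rev: "?rev (?rev c) = c" if "c \<in> sequences n lam" for c
    using that by (auto simp: fun_eq_iff sequences_def PiE_def extensional_def)
  have rev_in: "?rev c \<in> sequences n lam" if "c \<in> sequences n lam" for c
  proof -
    have bij: "bij_betw (\<lambda>j. n - j) {1..n-1} {1..n-1}"
      by (rule bij_betw_byWitness[where f' = "\<lambda>j. n - j"]) auto
    have "image_mset (?rev c) (mset_set {1..n-1}) = image_mset (\<lambda>j. c (n - j)) (mset_set {1..n-1})"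
      by (rule image_mset_cong) simp
    also have "\<dots> = image_mset c (image_mset (\<lambda>j. n - j) (mset_set {1..n-1}))"
      by (simp add: multiset.map_comp comp_def)
    also have "image_mset (\<lambda>j. n - j) (mset_set {1..n-1}) = mset_set {1..n-1}"
      using bij by (simp add: image_mset_mset_set bij_betw_def)
    finally have "nonzero_terms {1..n-1} (?rev c) = nonzero_terms {1..n-1} c"
      by (simp only: nonzero_terms_def)
    moreover have "?rev c \<in> {1..n-1} \<rightarrow>\<^sub>E UNIV"
      by simp
    ultimately show ?thesis
      using that by (simp only: sequences_def mem_Collect_eq)
  qed
  show ?thesis
    by (rule sum.reindex_bij_witness[where i = ?rev and j = ?rev]) (simp_all only: rev_rev rev_in)
qed

text \<open>
  The arrays are grouped by their column sums. With all parameters equal to \<open>d\<close>, column \<open>j\<close>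
  has total \<open>(n - j) d\<close>, which is the number of operators in front of the \<open>j\<close>-th letter from
  the right.
\<close>

lemma sum_arrays_eq_sum_gbinomial:
  assumes "n \<ge> 1"
  shows "(\<Sum>a\<in>{a \<in> arrays n. nonzero_terms {1..n-1} (col_sum n a) = mset lam}.
          1 / (\<Prod>ij\<in>array_index n. fact (a ij)) *
          (\<Prod>i = 2..n. falling (of_nat d) (row_sum a i))) =
    (\<Sum>i\<in>sequences n lam.
       \<Prod>j = 1..n-1. (of_nat (j * d) - (\<Sum>l = 1..<j. of_nat (i l)) :: 'a::field_char_0) gchoose (i j))"
proof -
  let ?A = "{a \<in> arrays n. nonzero_terms {1..n-1} (col_sum n a) = mset lam}"
  let ?f = "\<lambda>a. 1 / (\<Prod>ij\<in>array_index n. fact (a ij)) * (\<Prod>i = 2..n. falling (of_nat d) (row_sum a i)) :: 'a"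
  let ?cs = "\<lambda>a. restrict (col_sum n a) {1..n-1}"
  let ?g = "\<lambda>i. \<Prod>j = 1..n-1. (of_nat (j * d) - (\<Sum>l = 1..<j. of_nat (i l)) :: 'a) gchoose (i j)"
  have nz: "nonzero_terms {1..n-1} (restrict f {1..n-1}) = nonzero_terms {1..n-1} f" for f
    unfolding nonzero_terms_def by (intro arg_cong2[where f = filter_mset] refl image_mset_cong) simp
  have cs: "?cs a \<in> sequences n lam" if "a \<in> ?A" for a
    using that nz[of "col_sum n a"] by (auto simp: sequences_def)
  have fiber: "{a \<in> ?A. ?cs a = c} = arrays_with_col_sums n (n - 1) c" if c: "c \<in> sequences n lam" for c
  proof -
    have "?cs a = c \<longleftrightarrow> (\<forall>j\<in>{1..n-1}. col_sum n a j = c j)" for a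
      using c by (auto simp: fun_eq_iff sequences_def PiE_def extensional_def)
    moreover have "nonzero_terms {1..n-1} (col_sum n a) = mset lam" if "?cs a = c" for a
      using nz[of "col_sum n a"] c that by (simp add: sequences_def)
    ultimately show ?thesis
      unfolding arrays_with_col_sums_def arrays_def array_index_eq_cells by blast
  qed
  have "?A = (\<Union>c\<in>sequences n lam. {a \<in> ?A. ?cs a = c})"
    using cs by blast
  also have "\<dots> = (\<Union>c\<in>sequences n lam. arrays_with_col_sums n (n - 1) c)"
    using fiber by simp
  finally have "finite ?A"
    by (simp only: finite_UN_I finite_sequences finite_arrays_with_col_sums)
  then have "sum ?f ?A = (\<Sum>c\<in>sequences n lam. \<Sum>a | a \<in> ?A \<and> ?cs a = c. ?f a)"
    by (rule sum.group[symmetric]) (use cs in \<open>auto simp: finite_sequences\<close>)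
  also have "\<dots> = (\<Sum>c\<in>sequences n lam. \<Sum>a\<in>arrays_with_col_sums n (n - 1) c. ?f a)"
    by (rule sum.cong) (use fiber in auto)
  also have "\<dots> = (\<Sum>c\<in>sequences n lam. ?g (\<lambda>j\<in>{1..n-1}. c (n - j)))"
  proof (rule sum.cong[OF refl])
    fix c assume "c \<in> sequences n lam"
    have row: "row_sum a i = (\<Sum>j | 1 \<le> j \<and> j \<le> n - 1 \<and> j < i. a (i, j))" if "i \<in> {2..n}" for a i
      unfolding row_sum_def using that by (intro sum.cong) auto
    have "(\<Sum>a\<in>arrays_with_col_sums n (n - 1) c. ?f a) =
      (\<Sum>a\<in>arrays_with_col_sums n (n - 1) c.
         (\<Prod>i = 2..n. falling (of_nat d) (\<Sum>j | 1 \<le> j \<and> j \<le> n - 1 \<and> j < i. a (i, j))) /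
           (\<Prod>p\<in>cells n (n - 1). fact (a p)))"
      by (simp only: row array_index_eq_cells times_divide_eq_left mult_1 cong: prod.cong)
    also have "\<dots> = (\<Prod>j = 1..n-1. ((\<Sum>i = j + 1..n. of_nat d) - (\<Sum>l = j + 1..n-1. of_nat (c l))) gchoose c j)"
      by (rule sum_arrays_eq_prod_gbinomial)
    also have "\<dots> = ?g (\<lambda>j\<in>{1..n-1}. c (n - j))"
    proof (rule prod.reindex_bij_witness[where i = "\<lambda>j. n - j" and j = "\<lambda>j. n - j"])
      fix j assume j: "j \<in> {1..n-1}"
      have "(\<Sum>l = 1..<n - j. of_nat ((\<lambda>j\<in>{1..n-1}. c (n - j)) l)) = (\<Sum>l = j + 1..n-1. of_nat (c l) :: 'a)"
        by (rule sum.reindex_bij_witness[where i = "\<lambda>j. n - j" and j = "\<lambda>j. n - j"]) (use j in auto)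
      moreover have "(\<Sum>i = j + 1..n. of_nat d) = (of_nat ((n - j) * d) :: 'a)"
        by simp
      ultimately show "(of_nat ((n - j) * d) - (\<Sum>l = 1..<n - j. of_nat ((\<lambda>j\<in>{1..n-1}. c (n - j)) l)))
            gchoose (\<lambda>j\<in>{1..n-1}. c (n - j)) (n - j) =
         ((\<Sum>i = j + 1..n. of_nat d) - (\<Sum>l = j + 1..n-1. of_nat (c l)) :: 'a) gchoose c j"
        using j by auto
    qed auto
    finally show "(\<Sum>a\<in>arrays_with_col_sums n (n - 1) c. ?f a) = ?g (\<lambda>j\<in>{1..n-1}. c (n - j))" .
  qed
  also have "\<dots> = (\<Sum>i\<in>sequences n lam. ?g i)"
    by (rule sum_sequences_reverse[symmetric])
  finally show ?thesis .
qed

section \<open>The three formulas\<close>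

theorem corollary6p11:
  fixes n d k :: nat and lam :: "nat list"
  assumes "n \<ge> 1" and "d \<ge> 1"
    and "d \<le> k" and "k \<le> n * d"
    and "is_partition lam (n * d - k)"
    and "length lam \<le> n - 1"
  shows
    "rat_of_int (c_coeff n d lam) =
       (\<Sum>i\<in>sequences n lam.
          \<Prod>j = 1..n-1. (rat_of_nat (j * d) - (\<Sum>l = 1..<j. rat_of_nat (i l))) gchoose (i j)) \<and>
     rat_of_int (c_coeff n d lam) =
       1 / fact (k - d) * (1 / (\<Prod>p\<leftarrow>lam. fact p)) *
       (\<Sum>i\<in>{i \<in> sequences n lam. \<forall>j\<in>{1..n-1}. (\<Sum>l = 1..j. i l) \<le> j * d}.
          \<Prod>j = 1..n-1. falling (rat_of_nat (j * d) - (\<Sum>l = 1..<j. rat_of_nat (i l))) d) \<and>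
     rat_of_int (c_coeff n d lam) =
       (\<Sum>a\<in>{a \<in> arrays n. nonzero_terms {1..n-1} (col_sum n a) = mset lam}.
          1 / (\<Prod>ij\<in>array_index n. fact (a ij)) *
          (\<Prod>i = 2..n. falling (rat_of_nat d) (row_sum a i)))"
proof -
  have lam: "0 \<notin> set lam" "sum_list lam = n * d - k"
    using assms(5) by (auto simp: is_partition_def)
  have kd: "(n - 1) * d - sum_list lam = k - d"
    using assms(1,3,4) by (cases n) (auto simp: lam(2))
  note a = c_coeff_eq_sum_gbinomial[OF assms(6) lam(1) assms(1), where d = d and 'a = rat]
  note b = sum_gbinomial_eq_sum_falling[where n = n and d = d and lam = lam and 'a = rat, unfolded kd]
  note c = sum_arrays_eq_sum_gbinomial[OF assms(1), where d = d and lam = lam and 'a = rat]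
  show ?thesis
    unfolding a by (intro conjI refl b c[symmetric])
qed

end
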